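(* In the setting described in the context, the limit $C_{N_t,N_r}(\infty)=\lim_{\mathsf{SNR}\to\infty}C_{N_t,N_r}(\mathsf{SNR})$ is finite and satisfies $$M\log_2\!\Big(1+\frac{1}{\kappa^2}\Big)\le C_{N_t,N_r}(\infty)\le M\log_2\!\Big(1+\frac{N_t}{M\kappa^2}\Big),$$ where $M=\min(N_t,N_r)$. The lower bound is asymptotically (as $\mathsf{SNR}\to\infty$) achieved by the choice $\mathbf{Q}=\frac{1}{N_t}\mathbf{I}$, i.e., with Gaussian input $\mathbf{x}\sim\mathcal{CN}(\mathbf{0},\frac1{N_t}\mathbf{I})$. The two bounds coincide if $N_t\le N_r$.
   Context: Setting (MIMO channel with transmitter impairments). Let $N_t,N_r\ge1$ be the numbers of transmit and receive antennas, $\mathsf{SNR}>0$. The received signal is $\mathbf{y}=\sqrt{\mathsf{SNR}}\,\mathbf{H}(\mathbf{x}+\boldsymbol{\eta}_t)+\mathbf{n}\in\mathbb{C}^{N_r}$, where $\mathbf{x}\in\mathbb{C}^{N_t}$ is the intended signal with covariance $\mathbf{Q}=\mathbb{E}\{\mathbf{x}\mathbf{x}^H\}$ subject to $\mathrm{tr}(\mathbf{Q})=1$; $\mathbf{n}\sim\mathcal{CN}(\mathbf{0},\mathbf{I})$; the channel $\mathbf{H}\in\mathbb{C}^{N_r\times N_t}$ is a random matrix $\mathbb{H}$ with some distribution $f_{\mathbb{H}}$ satisfying $\mathbb{E}\{\mathrm{tr}(\mathbf{H}^H\mathbf{H})\}=N_tN_r$ and $\mathrm{rank}(\mathbf{H})=\min(N_t,N_r)$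 almost surely. The transmitter distortion is $\boldsymbol{\eta}_t\sim\mathcal{CN}(\mathbf{0},\boldsymbol{\Upsilon}_t(\mathbf{Q}))$, independent of $\mathbf{x}$, $\mathbf{n}$, $\mathbf{H}$, with $\boldsymbol{\Upsilon}_t(\mathbf{Q})=\mathrm{diag}(\upsilon_1(q_1),\dots,\upsilon_{N_t}(q_{N_t}))$, $q_n$ the $n$th diagonal element of $\mathbf{Q}$, and $\upsilon_n(q_n)=\kappa^2\big((1-\alpha)q_n+\alpha\frac{1}{N_t}\sum_{i=1}^{N_t}q_i\big)$ for fixed $\alpha\in[0,1]$, $\kappa>0$. The receiver knows $\mathbf{H}$, the transmitter only $f_{\mathbb{H}}$. The capacity is $C_{N_t,N_r}(\mathsf{SNR})=\sup_{f_{\mathbb{X}}:\ \mathrm{tr}(\mathbb{E}\{\mathbf{x}\mathbf{x}^H\})=1}\mathcal{I}(\mathbf{x};\mathbf{y}\mid\mathbb{H})$, where $\mathcal{I}(\mathbf{x};\mathbf{y}\mid\mathbb{H})=\mathbb{E}_{\mathbf{H}}\{\mathcal{I}(\mathbf{x};\mathbf{y}\mid\mathbb{H}=\mathbf{H})\}$; equivalently it equals $\sup_{\mathbf{Q}\succeq\mathbf{0},\,\mathrm{tr}(\mathbf{Q})=1}\mathbb{E}_{\mathbf{H}}\{\log_2\det(\mathbf{I}+\mathsf{SNR}\,\mathbf{H}\mathbf{Q}\mathbf{H}^H(\mathsf{SNR}\,\mathbf{H}\boldsymbol{\Upsilon}_t(\mathbf{Q})\mathbf{H}^H+\mathbf{I})^{-1})\}$,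 achieved by Gaussian inputs. *)

theory Defs
  imports "HOL-Analysis.Analysis" "HOL-Probability.Probability"
begin

definition cadj :: "complex^'n^'m \<Rightarrow> complex^'m^'n" where
  "cadj A = (\<chi> i j. cnj (A $ j $ i))"

definition psd :: "complex^'n^'n \<Rightarrow> bool" where
  "psd Q \<longleftrightarrow> cadj Q = Q \<and>
     (\<forall>x::complex^'n. 0 \<le> Re (\<Sum>i\<in>UNIV. cnj (x $ i) * (Q *v x) $ i))"

text \<open>Transmitter distortion covariance Upsilon_t(Q) = diag(upsilon_1(q_1),...,upsilon_Nt(q_Nt)),
  upsilon_n(q_n) = kappa^2((1-alpha) q_n + alpha (1/Nt) sum_i q_i), q_n the n-th diagonal entry of Q.\<close>
definition Upsilon :: "real \<Rightarrow> real \<Rightarrow> complex^'t^'t \<Rightarrow> complex^'t^'t" where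
  "Upsilon \<kappa> \<alpha> Q = (\<chi> i j. if i = j then
       complex_of_real (\<kappa>\<^sup>2 * ((1 - \<alpha>) * Re (Q $ i $ i)
          + \<alpha> * (1 / real CARD('t)) * (\<Sum>k\<in>UNIV. Re (Q $ k $ k))))
     else 0)"

definition rate :: "real \<Rightarrow> real \<Rightarrow> real \<Rightarrow> complex^'t^'r \<Rightarrow> complex^'t^'t \<Rightarrow> real" where
  "rate \<kappa> \<alpha> snr H Q =
     log 2 (Re (det (mat 1 + (snr *\<^sub>R (H ** Q ** cadj H))
        ** matrix_inv (snr *\<^sub>R (H ** Upsilon \<kappa> \<alpha> Q ** cadj H) + mat 1))))"

text \<open>Ergodic mutual information with Gaussian input of covariance Q; P is the channel law f_H.\<close>
definition avg_rate :: "(complex^'t^'r) measure \<Rightarrow> real \<Rightarrow> real \<Rightarrow> real \<Rightarrow> complex^'t^'t \<Rightarrow> real" where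
  "avg_rate P \<kappa> \<alpha> snr Q = integral\<^sup>L P (\<lambda>H. rate \<kappa> \<alpha> snr H Q)"

definition capacity :: "(complex^'t^'r) measure \<Rightarrow> real \<Rightarrow> real \<Rightarrow> real \<Rightarrow> real" where
  "capacity P \<kappa> \<alpha> snr =
     Sup ((\<lambda>Q. avg_rate P \<kappa> \<alpha> snr Q) ` {Q :: complex^'t^'t. psd Q \<and> trace Q = 1})"

end

theory Submission
  imports Defs
begin

text \<open>
  With \<open>B = H \<Upsilon> H\<^sup>*\<close> and \<open>A = H Q H\<^sup>*\<close> the rate is the logarithm of
  \<open>det (\<epsilon> I + B + A) / det (\<epsilon> I + B)\<close>, \<open>\<epsilon> = 1 / SNR\<close>. Inversion reverses and the determinant
  preserves the Loewner order, so this ratio grows with the SNR; since it is bounded, the capacity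
  is monotone and bounded, hence convergent.

  For the upper bound write the ratio as \<open>\<Prod>\<^sub>i (1 + d\<^sub>i)\<close>, with \<open>d\<close> the eigenvalues of the whitened signal
  covariance: at most \<open>M\<close> of them are nonzero, and their sum is at most
  \<open>\<Sum>\<^sub>n q\<^sub>n / \<upsilon>\<^sub>n \<le> N\<^sub>t / \<kappa>\<^sup>2\<close>, because \<open>N\<^sup>* (I + N N\<^sup>*)\<^sup>-\<^sup>1 N\<close> is a contraction and \<open>q / \<upsilon>(q)\<close> is concave.
  Concavity of the logarithm concludes. For \<open>Q = I / N\<^sub>t\<close> each nonzero eigenvalue of \<open>H H\<^sup>*\<close> contributes
  a factor tending to \<open>1 + 1 / \<kappa>\<^sup>2\<close>, and dominated convergence passes to the expectation.
\<close>

subsection \<open>Hermitian matrices\<close>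

lemma cadj_nth [simp]: "cadj A $ i $ j = cnj (A $ j $ i)"
  by (simp add: cadj_def)

lemma cadj_cadj [simp]: "cadj (cadj A) = A"
  by (simp add: vec_eq_iff)

lemma cadj_mult: "cadj (A ** B) = cadj B ** cadj A"
  by (simp add: vec_eq_iff matrix_matrix_mult_def mult.commute)

lemma cadj_add: "cadj (A + B) = cadj A + cadj B"
  by (simp add: vec_eq_iff)

lemma cadj_diff: "cadj (A - B) = cadj A - cadj B"
  by (simp add: vec_eq_iff)

lemma cadj_scaleR: "cadj (c *\<^sub>R A) = c *\<^sub>R cadj A"
  by (simp add: vec_eq_iff)

lemma cadj_mat_1 [simp]: "cadj (mat 1) = mat 1"
  by (simp add: vec_eq_iff mat_def)

lemma inner_cvec: "inner x y = Re (\<Sum>i\<in>UNIV. cnj (x $ i) * y $ i)"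
  for x y :: "complex^'n"
  by (simp add: inner_vec_def inner_complex_def)

lemma inner_cadj: "inner x (A *v y) = inner (cadj A *v x) y"
  for A :: "complex^'n^'m"
proof -
  have "(\<Sum>i\<in>UNIV. cnj (x $ i) * (A *v y) $ i)
      = (\<Sum>j\<in>UNIV. cnj ((cadj A *v x) $ j) * y $ j)"
    by (simp add: matrix_vector_mult_def sum_distrib_left sum_distrib_right mult_ac)
      (rule sum.swap)
  then show ?thesis
    by (simp add: inner_cvec)
qed

lemma cmatrix_vector_mult_scaleR: "A *v (c *\<^sub>R x) = c *\<^sub>R (A *v x)"
  for A :: "complex^'n^'m"
  by (intro linear_scale matrix_vector_mul_linear)

text \<open>The real inner product is only the real part of the Hermitian product. Multiplying by
  \<open>\<i>\<close> recovers the imaginary part, so complex orthogonality becomes two real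
  orthogonality conditions.\<close>

lemma inner_scalar_i: "inner (\<i> *s x) y = Im (\<Sum>i\<in>UNIV. cnj (x $ i) * y $ i)"
  for x y :: "complex^'n"
  by (simp add: inner_vec_def inner_complex_def sum_negf[symmetric] algebra_simps)

lemma hermitian_product_eq:
  "(\<Sum>i\<in>UNIV. cnj (x $ i) * y $ i) = Complex (inner x y) (inner (\<i> *s x) y)"
  for x y :: "complex^'n"
  by (simp add: inner_cvec[of x y] inner_scalar_i complex_eq_iff del: Re_sum Im_sum)

section \<open>Spectral theorem for Hermitian matrices\<close>

lemma linear_coeff_zero:
  fixes b c :: real
  assumes "\<And>t. 0 \<le> b * t + c * t\<^sup>2"
  shows "b = 0"
proof (rule ccontr)
  assume b: "b \<noteq> 0"
  \<comment> \<open>At \<open>t = -(b/k)\<close> with \<open>k\<close> larger than \<open>c\<close>,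
    the linear term outweighs the quadratic one and the sum is negative.\<close>
  define k where "k = 2 * (\<bar>c\<bar> + 1)"
  have k: "k > 0" "c < k" unfolding k_def by auto
  have "0 \<le> b * (-(b/k)) + c * (-(b/k))\<^sup>2"
    by (rule assms)
  also have "\<dots> = (b\<^sup>2 / k\<^sup>2) * (c - k)"
    using k by (simp add: field_simps power2_eq_square)
  also have "\<dots> < 0"
    using b k by (intro mult_pos_neg) auto
  finally show False by simp
qed

text \<open>Rayleigh quotient argument: \<open>inner x (A *v x)\<close> attains its maximum
  \<open>l\<close> on the unit sphere of the orthogonal complement \<open>V\<close> of the given
  eigenvectors. Since \<open>A\<close> maps the maximiser back into \<open>V\<close>, the
  first-order condition within \<open>V\<close> makes it an eigenvector.\<close>

lemma orthogonal_eigenvector_exists: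
  fixes A :: "complex^'n^'n" and e :: "'i \<Rightarrow> complex^'n"
  assumes herm: "cadj A = A" and fin: "finite S" and card: "card S < CARD('n)"
    and eig: "\<And>i. i \<in> S \<Longrightarrow> A *v e i = d i *\<^sub>R e i"
  obtains u and l :: real where "A *v u = l *\<^sub>R u" "norm u = 1"
    "\<And>i. i \<in> S \<Longrightarrow> inner (e i) u = 0" "\<And>i. i \<in> S \<Longrightarrow> inner (\<i> *s e i) u = 0"
proof -
  \<comment> \<open>Including the multiples by \<open>\<i>\<close> makes the real orthogonal
    complement of \<open>T\<close> the complex one.\<close>
  define T where "T = e ` S \<union> (\<lambda>i. \<i> *s e i) ` S"
  have finT: "finite T" unfolding T_def using fin by simp
  have "dim T \<le> card T" by (rule dim_le_card[OF span_superset finT])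
  also have "\<dots> \<le> card (e ` S) + card ((\<lambda>i. \<i> *s e i) ` S)"
    unfolding T_def by (rule card_Un_le)
  also have "\<dots> \<le> card S + card S"
    by (intro add_mono card_image_le fin)
  \<comment> \<open>The real dimension of the space is twice \<open>CARD('n)\<close>, which absorbs
    the doubling in \<open>T\<close>.\<close>
  also have "\<dots> < DIM(complex^'n)" using card by simp
  finally obtain v where v: "v \<noteq> 0" "\<And>y. y \<in> span T \<Longrightarrow> orthogonal v y"
    using orthogonal_to_subspace_exists by blast
  define V where "V = {x. \<forall>y\<in>T. orthogonal y x}"
  have subV: "subspace V"
    by (auto simp: V_def subspace_def orthogonal_def inner_add_right)
  have vV: "v \<in> V"
    using v(2) by (auto simp: V_def orthogonal_commute span_base)
  define K where "K = V \<inter> sphere 0 1"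
  have "compact K" unfolding K_def
    by (intro closed_Int_compact closed_subspace subV) auto
  moreover have "(1 / norm v) *\<^sub>R v \<in> K"
    using v(1) vV subspace_scale[OF subV] by (simp add: K_def)
  moreover have "continuous_on K (\<lambda>x. inner x (A *v x))"
    by (intro continuous_intros linear_continuous_on
        linear_conv_bounded_linear[THEN iffD1] matrix_vector_mul_linear)
  ultimately obtain u where u: "u \<in> K" and max: "\<And>x. x \<in> K \<Longrightarrow> inner x (A *v x) \<le> inner u (A *v u)"
    using continuous_attains_sup[of K "\<lambda>x. inner x (A *v x)"] by blast
  define l where "l = inner u (A *v u)"
  have uV: "u \<in> V" and nu: "norm u = 1" using u by (auto simp: K_def)
  have rayleigh: "inner x (A *v x) \<le> l * inner x x" if "x \<in> V" for x
  proof (cases "x = 0")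
    case False
    have "(1 / norm x) *\<^sub>R x \<in> K"
      using False that subspace_scale[OF subV] by (simp add: K_def)
    from max[OF this] have "inner x (A *v x) / (norm x)\<^sup>2 \<le> l"
      by (simp add: l_def cmatrix_vector_mult_scaleR power2_eq_square)
    then show ?thesis
      using False by (simp add: power2_norm_eq_inner pos_divide_le_eq mult.commute)
  qed simp
  \<comment> \<open>Half the gradient at \<open>u\<close> of
    \<open>l * inner x x - inner x (A *v x)\<close>. This form is nonnegative on \<open>V\<close>
    and vanishes at \<open>u\<close>, so moving along \<open>w\<close> inside \<open>V\<close>
    forces the first-order term \<open>2 * inner w w\<close> to vanish.\<close>
  define w where "w = l *\<^sub>R u - A *v u"
  have Ji: "A *v (\<i> *s x) = \<i> *s (A *v x)" for x
    by (simp add: vector_scalar_commute)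
  have AuV: "A *v u \<in> V"
    unfolding V_def
  proof (clarsimp simp: T_def orthogonal_def, safe)
    fix i assume i: "i \<in> S"
    have o: "inner (e i) u = 0" "inner (\<i> *s e i) u = 0"
      using uV i by (auto simp: V_def T_def orthogonal_def)
    show "inner (e i) (A *v u) = 0"
      using o i by (simp add: inner_cadj herm eig)
    have "\<i> *s (d i *\<^sub>R e i) = d i *\<^sub>R (\<i> *s e i)"
      by (simp add: vec_eq_iff)
    then show "inner (\<i> *s e i) (A *v u) = 0"
      using o i by (simp add: inner_cadj herm Ji eig)
  qed
  have wV: "w \<in> V"
    unfolding w_def by (intro subspace_diff subspace_scale subV uV AuV)
  have "0 \<le> (2 * inner w w) * t + (l * inner w w - inner w (A *v w)) * t\<^sup>2" for t
  proof -
    have "u + t *\<^sub>R w \<in> V" by (intro subspace_add subspace_scale subV uV wV)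
    from rayleigh[OF this]
    have "0 \<le> l * inner (u + t *\<^sub>R w) (u + t *\<^sub>R w)
        - inner (u + t *\<^sub>R w) (A *v (u + t *\<^sub>R w))" by simp
    also have "\<dots> = (l * inner u u - l) + t * (2 * l * inner w u - inner w (A *v u) - inner u (A *v w))
        + t\<^sup>2 * (l * inner w w - inner w (A *v w))"
      by (simp add: l_def matrix_vector_right_distrib cmatrix_vector_mult_scaleR inner_add_left
          inner_add_right algebra_simps power2_eq_square inner_commute)
    also have "inner u (A *v w) = inner w (A *v u)"
      by (subst inner_cadj) (simp add: herm inner_commute)
    also have "2 * l * inner w u - inner w (A *v u) - inner w (A *v u) = 2 * inner w w"
      by (subst (5) w_def) (simp add: inner_diff_right)
    also have "inner u u = 1" using nu by (simp add: norm_eq_1)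
    finally show ?thesis by (simp add: algebra_simps)
  qed
  then have "2 * inner w w = 0" by (rule linear_coeff_zero)
  then have "A *v u = l *\<^sub>R u" by (simp add: w_def)
  then show thesis
    using that nu uV by (auto simp: V_def T_def orthogonal_def)
qed

definition cdiag :: "('n \<Rightarrow> real) \<Rightarrow> complex^'n^'n" where
  "cdiag d = (\<chi> i j. if i = j then complex_of_real (d i) else 0)"

lemma cdiag_nth: "cdiag d $ i $ j = (if i = j then complex_of_real (d i) else 0)"
  by (simp add: cdiag_def)

lemma cdiag_mult_left: "(cdiag d ** A) $ i $ j = complex_of_real (d i) * A $ i $ j"
  by (simp add: cdiag_nth matrix_matrix_mult_def if_distrib[of "\<lambda>x. x * _"] cong: if_cong)

lemma cdiag_mult_right: "(A ** cdiag d) $ i $ j = A $ i $ j * complex_of_real (d j)"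
  by (simp add: cdiag_nth matrix_matrix_mult_def if_distrib[of "\<lambda>x. _ * x"] cong: if_cong)

lemma cdiag_mult: "cdiag a ** cdiag b = cdiag (\<lambda>i. a i * b i)"
  by (simp add: vec_eq_iff cdiag_mult_left) (simp add: cdiag_nth)

lemma cadj_cdiag [simp]: "cadj (cdiag d) = cdiag d"
  by (simp add: vec_eq_iff cdiag_nth)

lemma cdiag_const: "cdiag (\<lambda>_. c) = mat (complex_of_real c)"
  by (simp add: vec_eq_iff cdiag_nth mat_def)

lemma det_cdiag: "det (cdiag d) = complex_of_real (\<Prod>i\<in>UNIV. d i)"
  by (subst det_diagonal) (auto simp: cdiag_nth)

text \<open>Orthonormal eigenvectors are built by induction over subsets \<open>S\<close> of the
  index type, \<open>orthogonal_eigenvector_exists\<close> supplying one more each time. At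
  \<open>S = UNIV\<close> they are the columns of \<open>U\<close>.\<close>

theorem spectral_theorem:
  fixes A :: "complex^'n^'n"
  assumes herm: "cadj A = A"
  obtains U :: "complex^'n^'n" and d where "cadj U ** U = mat 1" "U ** cadj U = mat 1" "A = U ** cdiag d ** cadj U"
proof -
  have "\<exists>(e :: 'n \<Rightarrow> complex^'n) d. (\<forall>i\<in>S. A *v e i = (d i :: real) *\<^sub>R e i) \<and>
     (\<forall>i\<in>S. \<forall>j\<in>S. (\<Sum>l\<in>UNIV. cnj (e i $ l) * e j $ l) = (if i = j then 1 else 0))" for S :: "'n set"
    using finite[of S]
  proof (induction S rule: finite_induct)
    case empty
    then show ?case by auto
  next
    case (insert k S)
    then obtain e :: "'n \<Rightarrow> complex^'n" and d where e: "\<And>i. i \<in> S \<Longrightarrow> A *v e i = (d i :: real) *\<^sub>R e i"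
      "\<And>i j. i \<in> S \<Longrightarrow> j \<in> S \<Longrightarrow> (\<Sum>l\<in>UNIV. cnj (e i $ l) * e j $ l) = (if i = j then 1 else 0)"
      by blast
    have "card (insert k S) \<le> CARD('n)" by (intro card_mono) auto
    then have "card S < CARD('n)" using insert by simp
    then obtain u l where u: "A *v u = l *\<^sub>R u" "norm u = 1"
      "\<And>i. i \<in> S \<Longrightarrow> inner (e i) u = 0" "\<And>i. i \<in> S \<Longrightarrow> inner (\<i> *s e i) u = 0"
      using orthogonal_eigenvector_exists[where S = S and e = e and d = d, OF herm insert(1) _ e(1)]
      by blast
    have uu: "(\<Sum>l\<in>UNIV. cnj (u $ l) * u $ l) = 1"
    proof -
      have "inner (\<i> *s u) u = 0"
        unfolding inner_scalar_i by (simp add: mult.commute)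
      then show ?thesis
        using u(2) by (simp add: hermitian_product_eq norm_eq_1 complex_eq_iff)
    qed
    have eu: "(\<Sum>l\<in>UNIV. cnj (e i $ l) * u $ l) = 0" if "i \<in> S" for i
      using u(3,4)[OF that] by (simp add: hermitian_product_eq complex_eq_iff)
    have ue: "(\<Sum>l\<in>UNIV. cnj (u $ l) * e i $ l) = 0" if "i \<in> S" for i
    proof -
      have "(\<Sum>l\<in>UNIV. cnj (u $ l) * e i $ l) = cnj (\<Sum>l\<in>UNIV. cnj (e i $ l) * u $ l)"
        by (simp add: mult.commute)
      then show ?thesis using eu[OF that] by simp
    qed
    show ?case
      using insert(2) e u(1) uu eu ue
      by (intro exI[of _ "e(k := u)"] exI[of _ "d(k := l)"]) (auto simp del: cnj_sum)
  qed
  from this[of UNIV] obtain e :: "'n \<Rightarrow> complex^'n" and d where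
    e: "\<And>i. A *v e i = (d i :: real) *\<^sub>R e i"
      "\<And>i j. (\<Sum>l\<in>UNIV. cnj (e i $ l) * e j $ l) = (if i = j then 1 else 0)"
    by auto
  define U where "U = (\<chi> l i. e i $ l)"
  have U1: "cadj U ** U = mat 1"
    by (simp add: vec_eq_iff matrix_matrix_mult_def U_def e(2) mat_def)
  then have U2: "U ** cadj U = mat 1"
    using matrix_left_right_inverse by blast
  have "(A ** U) $ i $ j = (A *v e j) $ i" for i j
    by (simp add: matrix_matrix_mult_def matrix_vector_mult_def U_def)
  also have "\<dots> i j = (U ** cdiag d) $ i $ j" for i j
    by (simp only: e(1)) (simp add: cdiag_mult_right U_def complex_eq_iff)
  finally have "A ** U = U ** cdiag d"
    by (simp add: vec_eq_iff)
  then have "A = U ** cdiag d ** cadj U"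
    by (metis U2 matrix_mul_assoc matrix_mul_rid)
  with U1 U2 show thesis by (rule that)
qed

subsection \<open>Positive semidefinite matrices\<close>

lemma psd_iff: "psd Q \<longleftrightarrow> cadj Q = Q \<and> (\<forall>x. 0 \<le> inner x (Q *v x))"
  by (simp add: psd_def inner_cvec)

definition pd :: "complex^'n^'n \<Rightarrow> bool" where
  "pd Q \<longleftrightarrow> cadj Q = Q \<and> (\<forall>x. x \<noteq> 0 \<longrightarrow> 0 < inner x (Q *v x))"

lemma pd_imp_psd: "pd A \<Longrightarrow> psd A"
  unfolding pd_def psd_iff by (metis inner_zero_left order.refl less_imp_le)

lemma pd_add_psd: "pd A \<Longrightarrow> psd B \<Longrightarrow> pd (A + B)"
  by (simp add: psd_iff pd_def cadj_add matrix_vector_mult_add_rdistrib inner_add_right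
      add_pos_nonneg)

lemma cscaleR_matrix_vector: "(c *\<^sub>R A) *v x = c *\<^sub>R (A *v x)"
  for A :: "complex^'n^'m"
  by (simp add: vec_eq_iff matrix_vector_mult_def scaleR_sum_right)

lemma cscaleR_matrix_mult: "(c *\<^sub>R A) ** B = c *\<^sub>R (A ** B)"
  for A :: "complex^'n^'m"
  by (simp add: vec_eq_iff matrix_matrix_mult_def scaleR_sum_right)

lemma cmatrix_mult_scaleR: "A ** (c *\<^sub>R B) = c *\<^sub>R (A ** B)"
  for A :: "complex^'n^'m"
  by (simp add: vec_eq_iff matrix_matrix_mult_def scaleR_sum_right)

lemma psd_scaleR: "psd A \<Longrightarrow> 0 \<le> c \<Longrightarrow> psd (c *\<^sub>R A)"
  by (simp add: psd_iff cadj_scaleR cscaleR_matrix_vector)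

lemma pd_mat_1: "pd (mat 1)"
  by (simp add: pd_def)

lemma mat_of_real: "mat (complex_of_real c) = c *\<^sub>R mat 1"
  by (simp add: vec_eq_iff mat_def) (simp add: complex_eq_iff)

lemma pd_mat: "0 < c \<Longrightarrow> pd (mat (complex_of_real c))"
  by (simp add: mat_of_real pd_def cadj_scaleR cscaleR_matrix_vector)

lemma psd_mat: "0 \<le> c \<Longrightarrow> psd (mat (complex_of_real c))"
  by (simp add: mat_of_real psd_scaleR pd_imp_psd pd_mat_1)

lemma psd_congruence:
  assumes "psd A"
  shows "psd (cadj B ** A ** B)"
proof -
  have "cadj (cadj B ** A ** B) = cadj B ** A ** B"
    using assms by (simp add: cadj_mult psd_iff matrix_mul_assoc)
  moreover have "inner x ((cadj B ** A ** B) *v x) = inner (B *v x) (A *v (B *v x))" for x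
    using inner_cadj[of "B *v x" A]
    by (simp add: matrix_vector_mul_assoc[symmetric] inner_cadj[of x "cadj B"])
  ultimately show ?thesis
    using assms by (simp add: psd_iff)
qed

lemma psd_congruence': "psd A \<Longrightarrow> psd (B ** A ** cadj B)"
  using psd_congruence[of A "cadj B"] by simp

lemma inner_axis_1: "inner (axis i 1) x = Re (x $ i)" for x :: "complex^'n"
  by (simp add: inner_axis' inner_complex_def)

lemma matrix_vector_axis_1: "(A *v axis j 1) $ i = A $ i $ j" for A :: "complex^'n^'m"
  by (simp add: matrix_vector_mult_def axis_def if_distrib[of "\<lambda>x. _ * x"] cong: if_cong)

lemma cmatrix_add_rdistrib: "(A + B) ** C = A ** C + B ** C"
  for A :: "complex^'n^'m"
  by (simp add: vec_eq_iff matrix_matrix_mult_def sum.distrib distrib_right)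

lemma psd_diag_nonneg: "psd A \<Longrightarrow> 0 \<le> Re (A $ i $ i)"
  by (metis inner_axis_1 matrix_vector_axis_1 psd_iff)

lemma psd_trace_nonneg: "psd A \<Longrightarrow> 0 \<le> Re (trace A)"
  by (simp add: trace_def psd_diag_nonneg sum_nonneg)

lemma unitary_conjugation_cancel:
  fixes U :: "complex^'n^'n"
  assumes "cadj U ** U = mat 1"
  shows "cadj U ** (U ** X ** cadj U) ** U = X"
proof -
  have "cadj U ** (U ** X ** cadj U) ** U = (cadj U ** U) ** X ** (cadj U ** U)"
    by (simp add: matrix_mul_assoc)
  then show ?thesis by (simp add: assms)
qed

lemma psd_spectral:
  fixes A :: "complex^'n^'n"
  assumes "psd A"
  obtains U :: "complex^'n^'n" and d where "cadj U ** U = mat 1" "U ** cadj U = mat 1" "A = U ** cdiag d ** cadj U"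
    "\<And>i. 0 \<le> d i"
proof -
  obtain U :: "complex^'n^'n" and d where U: "cadj U ** U = mat 1" "U ** cadj U = mat 1" "A = U ** cdiag d ** cadj U"
    using spectral_theorem assms psd_iff by blast
  have "cadj U ** A ** U = cdiag d"
    using unitary_conjugation_cancel[OF U(1)] U(3) by simp
  then have "psd (cdiag d)"
    using psd_congruence[OF assms] by metis
  then have "0 \<le> d i" for i
    using psd_diag_nonneg[of "cdiag d" i] by (simp add: cdiag_nth)
  with U that show thesis by blast
qed

lemma psd_cdiag: "(\<And>i. 0 \<le> d i) \<Longrightarrow> psd (cdiag d)"
proof -
  assume d: "\<And>i. 0 \<le> d i"
  have "cdiag d = cadj (cdiag (\<lambda>i. sqrt (d i))) ** mat 1 ** cdiag (\<lambda>i. sqrt (d i))"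
    by (simp add: cdiag_mult d)
  then show ?thesis
    using psd_congruence[OF pd_imp_psd[OF pd_mat_1]] by metis
qed

lemma psd_sqrt:
  fixes A :: "complex^'n^'n"
  assumes "psd A"
  obtains S :: "complex^'n^'n" where "cadj S = S" "S ** S = A"
proof -
  obtain U :: "complex^'n^'n" and d where U: "cadj U ** U = mat 1" "A = U ** cdiag d ** cadj U" "\<And>i. 0 \<le> d i"
    using psd_spectral[OF assms] by blast
  let ?S = "U ** cdiag (\<lambda>i. sqrt (d i)) ** cadj U"
  have "?S ** ?S = U ** cdiag (\<lambda>i. sqrt (d i)) ** (cadj U ** U) ** cdiag (\<lambda>i. sqrt (d i)) ** cadj U"
    by (simp add: matrix_mul_assoc)
  also have "\<dots> = U ** (cdiag (\<lambda>i. sqrt (d i)) ** cdiag (\<lambda>i. sqrt (d i))) ** cadj U"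
    by (simp add: U(1) matrix_mul_assoc)
  finally have "?S ** ?S = A"
    by (simp add: cdiag_mult U)
  moreover have "cadj ?S = ?S"
    by (simp add: cadj_mult matrix_mul_assoc)
  ultimately show thesis
    using that by blast
qed

lemma det_unitary_conjugation:
  fixes U :: "complex^'n^'n"
  assumes "U ** cadj U = mat 1"
  shows "det (U ** X ** cadj U) = det X"
proof -
  have "det (U ** X ** cadj U) = det (U ** cadj U) * det X"
    by (simp add: det_mul)
  then show ?thesis by (simp add: assms)
qed

lemma add_unitary_conjugation:
  fixes U :: "complex^'n^'n"
  assumes "U ** cadj U = mat 1"
  shows "mat (complex_of_real a) + b *\<^sub>R (U ** cdiag d ** cadj U) = U ** cdiag (\<lambda>i. a + b * d i) ** cadj U"
proof -
  have "cdiag (\<lambda>i. a + b * d i) = mat (complex_of_real a) + b *\<^sub>R cdiag d"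
    by (simp add: vec_eq_iff mat_def cdiag_nth) (simp add: complex_eq_iff)
  then show ?thesis
    by (simp add: mat_of_real matrix_add_ldistrib cmatrix_add_rdistrib cscaleR_matrix_mult
        cmatrix_mult_scaleR assms)
qed

text \<open>The rate sees only real parts of determinants. Knowing that these determinants are real
  lets multiplicativity pass to the real parts, and positivity allows division and
  logarithms.\<close>

lemma pd_det:
  fixes A :: "complex^'n^'n"
  assumes "pd A"
  shows "det A = complex_of_real (Re (det A))" "0 < Re (det A)"
proof -
  obtain U :: "complex^'n^'n" and d where U: "cadj U ** U = mat 1" "U ** cadj U = mat 1" "A = U ** cdiag d ** cadj U"
    using psd_spectral[OF pd_imp_psd[OF assms]] by blast
  have "0 < d i" for i
  proof -
    let ?e = "axis i 1 :: complex^'n"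
    have ne: "U *v ?e \<noteq> 0"
      by (metis U(1) axis_eq_0_iff matrix_vector_mul_assoc matrix_vector_mul_lid
          matrix_vector_mult_0_right zero_neq_one)
    have "d i = inner ?e ((cadj U ** A ** U) *v ?e)"
      using unitary_conjugation_cancel[OF U(1)] U(3)
      by (simp add: inner_axis_1 matrix_vector_axis_1 cdiag_nth)
    also have "\<dots> = inner (U *v ?e) (A *v (U *v ?e))"
      by (simp add: matrix_vector_mul_assoc[symmetric] inner_cadj[of _ "cadj U"])
    finally show ?thesis
      using assms ne by (simp add: pd_def)
  qed
  moreover have "det A = complex_of_real (\<Prod>i\<in>UNIV. d i)"
    by (simp add: U det_unitary_conjugation det_cdiag del: of_real_prod)
  ultimately show "det A = complex_of_real (Re (det A))" "0 < Re (det A)"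
    by (auto intro: prod_pos simp del: of_real_prod)
qed

section \<open>Inverses and whitening\<close>

lemma pd_det_neq_0: "pd A \<Longrightarrow> det A \<noteq> 0"
  using pd_det(2) by force

lemma matrix_inv_det_neq_0:
  fixes A :: "complex^'n^'n"
  assumes "det A \<noteq> 0"
  shows "A ** matrix_inv A = mat 1" "matrix_inv A ** A = mat 1"
proof -
  have "\<exists>A'. A ** A' = mat 1 \<and> A' ** A = mat 1"
    using assms by (simp add: invertible_det_nz[symmetric] invertible_def)
  then show "A ** matrix_inv A = mat 1" "matrix_inv A ** A = mat 1"
    unfolding matrix_inv_def by (metis (mono_tags, lifting) someI_ex)+
qed

lemma matrix_inv_unique:
  fixes A :: "complex^'n^'n"
  assumes "A ** B = mat 1"
  shows "matrix_inv A = B"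
proof -
  have "det A * det B = 1"
    using assms det_mul det_I by metis
  then have "matrix_inv A ** A = mat 1"
    by (intro matrix_inv_det_neq_0) auto
  then show ?thesis
    by (metis assms matrix_mul_assoc matrix_mul_lid matrix_mul_rid)
qed

lemma cadj_matrix_inv:
  assumes "cadj A = A" "det A \<noteq> 0"
  shows "cadj (matrix_inv A) = matrix_inv A"
proof -
  have "A ** cadj (matrix_inv A) = cadj (matrix_inv A ** A)"
    by (simp add: cadj_mult assms)
  also have "\<dots> = mat 1"
    using assms by (simp add: matrix_inv_det_neq_0)
  finally show ?thesis
    using matrix_inv_unique by metis
qed

text \<open>\<open>T\<close> is the whitening matrix of a noise covariance \<open>P\<close>: the
  inverse of the Hermitian square root of \<open>P\<close>.\<close>

lemma pd_inverse_sqrt: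
  fixes P :: "complex^'n^'n"
  assumes "pd P"
  obtains T :: "complex^'n^'n" where "cadj T = T" "T ** P ** T = mat 1" "T ** T = matrix_inv P"
proof -
  obtain S :: "complex^'n^'n" where S: "cadj S = S" "S ** S = P"
    using psd_sqrt pd_imp_psd assms by blast
  have "det S \<noteq> 0"
    using pd_det_neq_0[OF assms] S(2) by (auto simp: det_mul)
  note inv = matrix_inv_det_neq_0[OF this] cadj_matrix_inv[OF S(1) this]
  let ?T = "matrix_inv S"
  have T: "?T ** P ** ?T = mat 1"
    using S inv by (metis matrix_mul_assoc matrix_mul_rid)
  have "P ** (?T ** ?T) = S ** (S ** ?T) ** ?T"
    by (simp add: S(2)[symmetric] matrix_mul_assoc)
  then have "matrix_inv P = ?T ** ?T"
    by (intro matrix_inv_unique) (simp add: inv)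
  with that inv T show thesis by metis
qed

lemma pd_matrix_inv:
  assumes "pd P"
  shows "pd (matrix_inv P)"
proof -
  note inv = matrix_inv_det_neq_0[OF pd_det_neq_0[OF assms]]
  have h: "cadj (matrix_inv P) = matrix_inv P"
    using assms cadj_matrix_inv pd_det_neq_0 pd_def by blast
  have "0 < inner x (matrix_inv P *v x)" if "x \<noteq> 0" for x
  proof -
    have Px: "P *v (matrix_inv P *v x) = x"
      by (simp add: matrix_vector_mul_assoc inv)
    then have "matrix_inv P *v x \<noteq> 0"
      using that by auto
    then have "0 < inner (matrix_inv P *v x) (P *v (matrix_inv P *v x))"
      using assms pd_def by blast
    then show ?thesis by (simp add: Px inner_commute)
  qed
  with h show ?thesis by (simp add: pd_def)
qed

section \<open>Rank and the eigenvalues behind a ratio of determinants\<close>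

text \<open>The rows of \<open>V = cadj U ** W\<close> are pairwise orthogonal with squared norms
  \<open>d i\<close>, and they span the same space as the rows of \<open>W\<close>. The nonzero ones
  therefore form a basis of the row space.\<close>

lemma rank_unitary_diagonal:
  fixes W :: "complex^'t^'r" and U :: "complex^'r^'r"
  assumes U: "cadj U ** U = mat 1" "U ** cadj U = mat 1" "W ** cadj W = U ** cdiag d ** cadj U"
  shows "rank W = card {i. d i \<noteq> 0}"
proof -
  define V where "V = cadj U ** W"
  have "V ** cadj V = cadj U ** (W ** cadj W) ** U"
    by (simp add: V_def cadj_mult matrix_mul_assoc)
  then have VV: "V ** cadj V = cdiag d"
    using unitary_conjugation_cancel[OF U(1)] U(3) by simp
  have UV: "W = U ** V"
    by (simp add: V_def matrix_mul_assoc U(2))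
  have VVij: "(\<Sum>l\<in>UNIV. V $ i $ l * cnj (V $ j $ l)) = (if i = j then of_real (d i) else 0)" for i j
    using arg_cong[OF VV, of "\<lambda>X. X $ i $ j"] by (simp add: matrix_matrix_mult_def cdiag_nth)
  have V0: "V $ i = 0" if "d i = 0" for i
  proof -
    have "(\<Sum>l\<in>UNIV. (cmod (V $ i $ l))\<^sup>2) = 0"
      using arg_cong[OF VVij[of i i], of Re] that by (simp add: complex_mult_cnj cmod_power2)
    then show ?thesis by (simp add: sum_nonneg_eq_0_iff vec_eq_iff)
  qed
  let ?Z = "{i. d i \<noteq> 0}" and ?B = "(\<lambda>i. V $ i) ` {i. d i \<noteq> 0}"
  \<comment> \<open>Rows of a product are combinations of the rows of its right factor. Applied to
    \<open>W = U ** V\<close> and to \<open>V = cadj U ** W\<close>, this gives the two inclusions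
    of spans.\<close>
  have rows_mult: "(X ** Y) $ i = (\<Sum>k\<in>UNIV. X $ i $ k *s Y $ k)"
    for X :: "complex^'k^'m" and Y :: "complex^'l^'k" and i
    by (simp add: vec_eq_iff matrix_matrix_mult_def)
  have inj: "inj_on (\<lambda>i. V $ i) ?Z"
  proof (rule inj_onI)
    fix i j assume "i \<in> ?Z" "V $ i = V $ j"
    then show "i = j"
      using VVij[of i i] VVij[of i j] by (auto split: if_splits)
  qed
  have ind: "vec.independent ?B"
  proof (rule vec.independent_if_scalars_zero)
    fix f x assume sum0: "(\<Sum>x\<in>?B. f x *s x) = 0" and "x \<in> ?B"
    then obtain j where j: "x = V $ j" "d j \<noteq> 0" by auto
    have s: "(\<Sum>i\<in>?Z. f (V $ i) *s V $ i) = 0"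
      using sum0 by (simp add: sum.reindex[OF inj])
    \<comment> \<open>Pairing the vanishing combination with row \<open>j\<close> isolates the
      coefficient of that row, multiplied by \<open>d j\<close>.\<close>
    have "0 = (\<Sum>l\<in>UNIV. (\<Sum>i\<in>?Z. f (V $ i) *s V $ i) $ l * cnj (V $ j $ l))"
      by (simp only: s) simp
    also have "\<dots> = (\<Sum>i\<in>?Z. f (V $ i) * (\<Sum>l\<in>UNIV. V $ i $ l * cnj (V $ j $ l)))"
      by (simp add: sum_distrib_right sum_distrib_left mult_ac) (rule sum.swap)
    also have "\<dots> = f x * d j"
      using j by (simp add: VVij if_distrib[of "\<lambda>x. _ * x"] cong: if_cong)
    finally show "f x = 0" using j by simp
  qed simp
  have "vec.span (rows W) = vec.span ?B"
  proof (rule vec.span_eq[THEN iffD2], intro conjI subsetI)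
    fix x assume "x \<in> rows W"
    then obtain i where "x = W $ i" by (auto simp: rows_def row_def)
    then have x: "x = (\<Sum>k\<in>UNIV. U $ i $ k *s V $ k)"
      using UV rows_mult by metis
    have "V $ k \<in> vec.span ?B" for k
      by (cases "d k = 0") (auto simp: V0 vec.span_zero intro: vec.span_base)
    then show "x \<in> vec.span ?B"
      unfolding x by (intro vec.span_sum vec.span_scale)
  next
    fix x assume "x \<in> ?B"
    then obtain i where "x = V $ i" by auto
    then have x: "x = (\<Sum>k\<in>UNIV. cadj U $ i $ k *s W $ k)"
      using V_def rows_mult by metis
    have "W $ k \<in> vec.span (rows W)" for k
      by (intro vec.span_base) (auto simp: rows_def row_def)
    then show "x \<in> vec.span (rows W)"
      unfolding x by (intro vec.span_sum vec.span_scale)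
  qed
  then have "vec.dim (rows W) = card ?B"
    using vec.dim_eq_card[OF _ ind] by metis
  then show ?thesis
    by (simp add: row_rank_def_gen card_image[OF inj])
qed

lemma rank_le_min: "rank W \<le> min CARD('t) CARD('r)" for W :: "complex^'t^'r"
proof -
  have "rows W = range (\<lambda>i. row i W)" by (auto simp: rows_def)
  then have f: "finite (rows W)" "card (rows W) \<le> CARD('r)"
    by (auto intro: card_image_le)
  have "rank W \<le> card (rows W)"
    unfolding row_rank_def_gen by (rule vec.dim_le_card) (auto intro: vec.span_base f)
  moreover have "rank W \<le> CARD('t)"
    unfolding row_rank_def_gen
    using vec.dim_subset_UNIV[of "rows W"] by (simp add: vec.dimension_def card_cart_basis)
  ultimately show ?thesis using f by simp
qed

text \<open>Whitening by \<open>T\<close> turns \<open>P\<close> into the identity and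
  \<open>L\<close> into \<open>W = T ** L\<close>; the \<open>d i\<close> are the eigenvalues of
  \<open>W ** cadj W\<close>. Cyclicity of the trace gives their sum, and the rank of
  \<open>W\<close> counts the nonzero ones.\<close>

lemma det_ratio_eigenvalues:
  fixes P :: "complex^'r^'r" and L :: "complex^'t^'r"
  assumes "pd P"
  obtains d :: "'r \<Rightarrow> real" where "\<forall>i. 0 \<le> d i" "det (P + L ** cadj L) = det P * of_real (\<Prod>i\<in>UNIV. 1 + d i)"
    "(\<Sum>i\<in>UNIV. d i) = Re (trace (cadj L ** matrix_inv P ** L))"
    "card {i. d i \<noteq> 0} \<le> min CARD('t) CARD('r)"
proof -
  obtain T :: "complex^'r^'r" where T: "cadj T = T" "T ** P ** T = mat 1" "T ** T = matrix_inv P"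
    using pd_inverse_sqrt[OF assms] by blast
  define W where "W = T ** L"
  have "psd (W ** mat 1 ** cadj W)"
    by (intro psd_congruence' pd_imp_psd pd_mat_1)
  then have "psd (W ** cadj W)" by simp
  then obtain U :: "complex^'r^'r" and d where U: "cadj U ** U = mat 1" "U ** cadj U = mat 1"
    "W ** cadj W = U ** cdiag d ** cadj U" "\<And>i. 0 \<le> d i"
    using psd_spectral by blast
  have detT: "det T * det P * det T = 1"
    using arg_cong[OF T(2), of det] by (simp add: det_mul)
  have WW: "W ** cadj W = T ** (L ** cadj L) ** T"
    by (simp add: W_def cadj_mult T(1) matrix_mul_assoc)
  have "T ** (P + L ** cadj L) ** T = mat 1 + W ** cadj W"
    by (simp add: matrix_add_ldistrib cmatrix_add_rdistrib T(2) WW)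
  also have "\<dots> = U ** cdiag (\<lambda>i. 1 + d i) ** cadj U"
    using add_unitary_conjugation[OF U(2), of 1 1 d] U(3) by simp
  finally have "det T * det (P + L ** cadj L) * det T = of_real (\<Prod>i\<in>UNIV. 1 + d i)"
    by (metis U(2) det_cdiag det_mul det_unitary_conjugation)
  then have "(det T * det P * det T) * det (P + L ** cadj L) = det P * of_real (\<Prod>i\<in>UNIV. 1 + d i)"
    by (simp add: algebra_simps)
  then have 1: "det (P + L ** cadj L) = det P * of_real (\<Prod>i\<in>UNIV. 1 + d i)"
    by (simp add: detT)
  have "(\<Sum>i\<in>UNIV. d i) = Re (trace (cdiag d))"
    by (simp add: trace_def cdiag_nth)
  also have "trace (cdiag d) = trace (cadj U ** (U ** cdiag d))"
    by (simp add: matrix_mul_assoc U(1))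
  also have "\<dots> = trace (W ** cadj W)"
    by (subst trace_mul_sym) (simp add: U(3))
  also have "\<dots> = trace (cadj W ** W)"
    by (rule trace_mul_sym)
  also have "cadj W ** W = cadj L ** (T ** T) ** L"
    by (simp add: W_def cadj_mult T(1) matrix_mul_assoc)
  finally have 2: "(\<Sum>i\<in>UNIV. d i) = Re (trace (cadj L ** matrix_inv P ** L))"
    by (simp add: T(3))
  have 3: "card {i. d i \<noteq> 0} \<le> min CARD('t) CARD('r)"
    using rank_unitary_diagonal[OF U(1-3)] rank_le_min[of W] by simp
  show thesis
    using that[of d] U(4) 1 2 3 by blast
qed

subsection \<open>Loewner monotonicity\<close>

text \<open>With \<open>Y\<close> written as a Hermitian square, the two determinants differ by a
  product of factors \<open>1 + d i\<close>, each at least 1.\<close>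

lemma pd_det_mono:
  fixes X Y :: "complex^'n^'n"
  assumes "pd X" "psd Y"
  shows "Re (det X) \<le> Re (det (X + Y))"
proof -
  obtain S where S: "cadj S = S" "S ** S = Y"
    using psd_sqrt[OF assms(2)] by blast
  obtain d :: "'n \<Rightarrow> real" where d: "\<forall>i. 0 \<le> d i"
    "det (X + S ** cadj S) = det X * of_real (\<Prod>i\<in>UNIV. 1 + d i)"
    using det_ratio_eigenvalues[OF assms(1), of S] by blast
  have "1 \<le> (\<Prod>i\<in>UNIV. 1 + d i)"
    by (intro prod_ge_1) (simp add: d)
  moreover have "Re (det (X + Y)) = Re (det X) * (\<Prod>i\<in>UNIV. 1 + d i)"
    using d(2) by (simp add: S del: of_real_prod)
  ultimately show ?thesis
    using pd_det(2)[OF assms(1)] by (simp add: mult_le_cancel_left1)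
qed

text \<open>For the solutions \<open>u\<close> of \<open>P *v u = x\<close> and \<open>v\<close> of
  \<open>(P + A) *v v = x\<close>, expanding \<open>0 \<le> inner (u - v) (P *v (u - v))\<close>
  bounds \<open>inner x u - inner x v\<close> below by \<open>inner v (A *v v)\<close>.\<close>

lemma pd_matrix_inv_antimono:
  assumes "pd P" "psd A"
  shows "psd (matrix_inv P - matrix_inv (P + A))"
proof -
  note pPA = pd_add_psd[OF assms]
  note inv = matrix_inv_det_neq_0(1)[OF pd_det_neq_0[OF assms(1)]]
    matrix_inv_det_neq_0(1)[OF pd_det_neq_0[OF pPA]]
  have h: "cadj P = P" "cadj (matrix_inv P) = matrix_inv P"
    "cadj (matrix_inv (P + A)) = matrix_inv (P + A)"
    using assms(1) pd_matrix_inv[OF assms(1)] pd_matrix_inv[OF pPA] by (simp_all add: pd_def)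
  have "0 \<le> inner x ((matrix_inv P - matrix_inv (P + A)) *v x)" for x
  proof -
    define u v where "u = matrix_inv P *v x" and "v = matrix_inv (P + A) *v x"
    have u: "P *v u = x" by (simp add: u_def matrix_vector_mul_assoc inv)
    have "(P + A) *v v = x" by (simp add: v_def matrix_vector_mul_assoc inv)
    then have v: "P *v v = x - A *v v" by (simp add: matrix_vector_mult_add_rdistrib eq_diff_eq)
    have uv: "inner u (P *v v) = inner x v"
      by (subst inner_cadj) (simp add: h u)
    have "0 \<le> inner (u - v) (P *v (u - v))"
      using pd_imp_psd[OF assms(1)] by (simp add: psd_iff)
    also have "\<dots> = inner x u - inner x v - inner v (A *v v)"
      using uv by (simp add: matrix_vector_mult_diff_distrib u inner_diff_left inner_diff_right inner_commute v)
    finally have "inner v (A *v v) \<le> inner x u - inner x v" by simp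
    moreover have "0 \<le> inner v (A *v v)" using assms(2) by (simp add: psd_iff)
    ultimately show ?thesis
      by (simp add: matrix_vector_mult_diff_rdistrib inner_diff_right u_def v_def)
  qed
  then show ?thesis by (simp add: psd_iff cadj_diff h)
qed

text \<open>Factoring \<open>B\<close> out of \<open>B\<close> plus \<open>e\<close> times the
  identity leaves the determinant of the identity plus \<open>e\<close> times the inverse of
  \<open>B\<close>. For \<open>B = P + A\<close> this factor is at most the one for
  \<open>B = P\<close>, because inversion reverses the Loewner order.\<close>

lemma det_ratio_antimono:
  fixes P A :: "complex^'n^'n"
  assumes "pd P" "psd A" "0 \<le> e"
  shows "Re (det (P + mat (complex_of_real e) + A)) / Re (det (P + mat (complex_of_real e)))
    \<le> Re (det (P + A)) / Re (det P)"
proof -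
  note pPA = pd_add_psd[OF assms(1,2)]
  have factor: "Re (det (B + mat (complex_of_real e))) = Re (det B) * Re (det (mat 1 + e *\<^sub>R matrix_inv B))"
    if "pd B" for B :: "complex^'n^'n"
  proof -
    have "B + mat (complex_of_real e) = B ** (mat 1 + e *\<^sub>R matrix_inv B)"
      using matrix_inv_det_neq_0(1)[OF pd_det_neq_0[OF that]]
      by (simp add: matrix_add_ldistrib cmatrix_mult_scaleR mat_of_real)
    then have "det (B + mat (complex_of_real e)) = det B * det (mat 1 + e *\<^sub>R matrix_inv B)"
      by (metis det_mul)
    moreover have "pd (mat 1 + e *\<^sub>R matrix_inv B)"
      by (intro pd_add_psd pd_mat_1 psd_scaleR pd_imp_psd pd_matrix_inv that assms)
    ultimately show ?thesis
      using pd_det(1) that by (metis Re_complex_of_real of_real_mult)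
  qed
  let ?X = "mat 1 + e *\<^sub>R matrix_inv (P + A)" and ?Y = "mat 1 + e *\<^sub>R matrix_inv P"
  have X: "pd ?X" and Y: "pd ?Y"
    by (intro pd_add_psd pd_mat_1 psd_scaleR pd_imp_psd pd_matrix_inv assms pPA)+
  have "Re (det ?X) \<le> Re (det (?X + e *\<^sub>R (matrix_inv P - matrix_inv (P + A))))"
    by (intro pd_det_mono X psd_scaleR pd_matrix_inv_antimono assms)
  also have "?X + e *\<^sub>R (matrix_inv P - matrix_inv (P + A)) = ?Y"
    by (simp add: scaleR_diff_right)
  finally have "Re (det (P + A)) * Re (det ?X) / (Re (det P) * Re (det ?Y)) \<le> Re (det (P + A)) / Re (det P)"
    using pd_det(2)[OF Y] pd_det(2)[OF assms(1)] pd_det(2)[OF pPA]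
    by (simp add: field_simps)
  moreover have "P + mat (complex_of_real e) + A = (P + A) + mat (complex_of_real e)"
    by (simp add: add_ac)
  ultimately show ?thesis
    by (simp only: factor[OF assms(1)] factor[OF pPA])
qed

text \<open>The subtracted matrix sends \<open>x\<close> to \<open>y = cadj N *v w\<close>, where
  \<open>w\<close> solves the regularized system. Then
  \<open>inner x y = inner w w + inner y y\<close>, so \<open>inner y y \<le> inner x y\<close>;
  expanding \<open>inner (x - y) (x - y)\<close> gives
  \<open>inner x y \<le> inner x x\<close>.\<close>

lemma psd_regularized_projection:
  fixes N :: "complex^'t^'r"
  shows "psd (mat 1 - cadj N ** matrix_inv (mat 1 + N ** cadj N) ** N)"
proof -
  let ?P = "mat 1 + N ** cadj N"
  have "psd (N ** mat 1 ** cadj N)"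
    by (intro psd_congruence' pd_imp_psd pd_mat_1)
  then have P: "pd ?P"
    by (intro pd_add_psd pd_mat_1) simp
  have h: "cadj (matrix_inv ?P) = matrix_inv ?P"
    using pd_matrix_inv[OF P] by (simp add: pd_def)
  have "inner x ((cadj N ** matrix_inv ?P ** N) *v x) \<le> inner x x" for x
  proof -
    define w where "w = matrix_inv ?P *v (N *v x)"
    define y where "y = cadj N *v w"
    have "?P *v w = N *v x"
      unfolding w_def matrix_vector_mul_assoc[of ?P]
      by (simp add: matrix_inv_det_neq_0 pd_det_neq_0 P)
    then have w: "N *v x = w + N *v y"
      by (simp add: matrix_vector_mult_add_rdistrib y_def matrix_vector_mul_assoc)
    have xy: "inner x y = inner w (N *v x)"
      by (subst inner_cadj) (simp add: y_def inner_commute)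
    also have "\<dots> = inner w w + inner y y"
      unfolding w inner_add_right inner_cadj[of w N] y_def[symmetric] ..
    finally have "inner y y \<le> inner x y" by simp
    moreover have "0 \<le> inner (x - y) (x - y)" by simp
    ultimately have "inner x y \<le> inner x x"
      by (simp add: inner_diff_left inner_diff_right inner_commute)
    then show ?thesis
      by (simp add: y_def w_def matrix_vector_mul_assoc matrix_mul_assoc)
  qed
  then show ?thesis
    by (simp add: psd_iff cadj_diff cadj_mult h matrix_mul_assoc matrix_vector_mult_diff_rdistrib
        inner_diff_right)
qed

subsection \<open>The rate\<close>

text \<open>Diagonal of \<open>Upsilon\<close> under the power constraint: at unit trace the mean
  power per antenna is \<open>1 / CARD('t)\<close>.\<close>

definition distortion :: "real \<Rightarrow> real \<Rightarrow> complex^'t^'t \<Rightarrow> 't \<Rightarrow> real" where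
  "distortion \<kappa> \<alpha> Q i = \<kappa>\<^sup>2 * ((1 - \<alpha>) * Re (Q $ i $ i) + \<alpha> / real CARD('t))"

lemma Upsilon_eq_cdiag:
  assumes "trace Q = 1"
  shows "Upsilon \<kappa> \<alpha> Q = cdiag (distortion \<kappa> \<alpha> Q)"
proof -
  have "(\<Sum>k\<in>UNIV. Re (Q $ k $ k)) = 1"
    using arg_cong[OF assms, of Re] by (simp add: trace_def)
  then show ?thesis
    by (simp add: Upsilon_def distortion_def cdiag_def vec_eq_iff)
qed

lemma distortion_nonneg:
  "psd Q \<Longrightarrow> 0 \<le> \<alpha> \<Longrightarrow> \<alpha> \<le> 1 \<Longrightarrow> 0 \<le> distortion \<kappa> \<alpha> Q i"
  by (simp add: distortion_def psd_diag_nonneg)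

lemma psd_Upsilon:
  "psd Q \<Longrightarrow> trace Q = 1 \<Longrightarrow> 0 \<le> \<alpha> \<Longrightarrow> \<alpha> \<le> 1 \<Longrightarrow> psd (Upsilon \<kappa> \<alpha> Q)"
  by (simp add: Upsilon_eq_cdiag psd_cdiag distortion_nonneg)

text \<open>In the normalised power \<open>x\<close> (1 at uniform allocation) each ratio is
  \<open>x / ((1 - \<alpha>) * x + \<alpha>)\<close> up to \<open>1 / \<kappa>\<^sup>2\<close>. It
  lies below the tangent \<open>1 - \<alpha> + \<alpha> * x\<close> at \<open>x = 1\<close>, and the
  tangents add up to \<open>CARD('t)\<close> by the trace constraint.\<close>

lemma sum_power_over_distortion_le:
  fixes Q :: "complex^'t^'t"
  assumes Q: "psd Q" "trace Q = 1" and \<alpha>: "0 \<le> \<alpha>" "\<alpha> \<le> 1" and \<kappa>: "0 < \<kappa>"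
  shows "(\<Sum>i\<in>UNIV. Re (Q $ i $ i) / distortion \<kappa> \<alpha> Q i) \<le> real CARD('t) / \<kappa>\<^sup>2"
proof -
  let ?N = "real CARD('t)"
  have tangent: "Re (Q $ i $ i) / distortion \<kappa> \<alpha> Q i \<le> (1 - \<alpha> + \<alpha> * (?N * Re (Q $ i $ i))) / \<kappa>\<^sup>2" for i
  proof -
    define x where "x = ?N * Re (Q $ i $ i)"
    have x: "0 \<le> x" using psd_diag_nonneg[OF Q(1)] by (simp add: x_def)
    define D where "D = (1 - \<alpha>) * x + \<alpha>"
    have D0: "0 \<le> D" using x \<alpha> by (simp add: D_def)
    have "(1 - \<alpha> + \<alpha> * x) * D - x = \<alpha> * (1 - \<alpha>) * (x - 1)\<^sup>2"
      by (simp add: D_def power2_eq_square algebra_simps)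
    moreover have "0 \<le> \<alpha> * (1 - \<alpha>) * (x - 1)\<^sup>2" using \<alpha> by simp
    ultimately have le: "x \<le> (1 - \<alpha> + \<alpha> * x) * D" by linarith
    have "x / D \<le> 1 - \<alpha> + \<alpha> * x"
    \<comment> \<open>At \<open>D = 0\<close> the quotient is 0 by convention, and the tangent value
      is nonnegative.\<close>
    proof (cases "D = 0")
      case False
      then show ?thesis using le D0 by (simp add: pos_divide_le_eq)
    qed (use x \<alpha> in simp)
    moreover have "Re (Q $ i $ i) / distortion \<kappa> \<alpha> Q i = x / D / \<kappa>\<^sup>2"
    proof -
      have "Re (Q $ i $ i) = x / ?N" "distortion \<kappa> \<alpha> Q i = \<kappa>\<^sup>2 * (D / ?N)"
        by (simp_all add: x_def D_def distortion_def field_simps)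
      then show ?thesis by simp
    qed
    ultimately show ?thesis
      using \<kappa> unfolding x_def[symmetric] by (metis divide_right_mono zero_le_power2)
  qed
  have tr: "(\<Sum>i\<in>UNIV. Re (Q $ i $ i)) = 1"
    using arg_cong[OF Q(2), of Re] by (simp add: trace_def)
  have "(\<Sum>i\<in>UNIV. Re (Q $ i $ i) / distortion \<kappa> \<alpha> Q i)
      \<le> (\<Sum>i\<in>(UNIV :: 't set). (1 - \<alpha> + \<alpha> * (?N * Re (Q $ i $ i))) / \<kappa>\<^sup>2)"
    by (intro sum_mono tangent)
  also have "\<dots> = (\<Sum>i\<in>(UNIV :: 't set). 1 - \<alpha> + \<alpha> * (?N * Re (Q $ i $ i))) / \<kappa>\<^sup>2"
    by (rule sum_divide_distrib[symmetric])
  also have "(\<Sum>i\<in>(UNIV :: 't set). 1 - \<alpha> + \<alpha> * (?N * Re (Q $ i $ i)))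
      = ?N * (1 - \<alpha>) + \<alpha> * (?N * (\<Sum>i\<in>UNIV. Re (Q $ i $ i)))"
    by (simp add: sum.distrib sum_subtractf sum_distrib_left algebra_simps)
  also have "\<dots> = ?N" by (simp add: tr algebra_simps)
  finally show ?thesis .
qed

text \<open>Write \<open>Upsilon\<close> as the square of \<open>\<Lambda>\<close> and
  \<open>R\<close> as \<open>\<Lambda> ** M\<close>. The trace becomes that of
  \<open>cadj M ** K ** M\<close>, with \<open>K\<close> the regularized projection for
  \<open>N = H ** \<Lambda>\<close>. As \<open>K\<close> is bounded by the identity, the channel
  drops out and the trace of \<open>M ** cadj M\<close>, the sum of power over distortion,
  remains.\<close>

lemma whitened_signal_trace_le:
  fixes H :: "complex^'t^'r" and Q R :: "complex^'t^'t"
  assumes Q: "psd Q" "trace Q = 1" and \<alpha>: "0 \<le> \<alpha>" "\<alpha> \<le> 1" and \<kappa>: "0 < \<kappa>"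
    and R: "cadj R = R" "R ** R = Q"
  shows "Re (trace (cadj (H ** R) ** matrix_inv (mat 1 + H ** Upsilon \<kappa> \<alpha> Q ** cadj H) ** (H ** R)))
    \<le> real CARD('t) / \<kappa>\<^sup>2"
proof -
  let ?v = "distortion \<kappa> \<alpha> Q"
  note v0 = distortion_nonneg[OF Q(1) \<alpha>]
  define \<Lambda> where "\<Lambda> = cdiag (\<lambda>i. sqrt (?v i))"
  define M where "M = cdiag (\<lambda>i. 1 / sqrt (?v i)) ** R"
  have Rrow: "(\<Sum>j\<in>UNIV. (cmod (R $ i $ j))\<^sup>2) = Re (Q $ i $ i)" for i
  proof -
    have "Re (Q $ i $ i) = Re ((R ** cadj R) $ i $ i)"
      by (simp add: R)
    also have "\<dots> = (\<Sum>j\<in>UNIV. (cmod (R $ i $ j))\<^sup>2)"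
      by (simp add: matrix_matrix_mult_def cmod_power2) (simp add: power2_eq_square)
    finally show ?thesis ..
  qed
  \<comment> \<open>Where the distortion vanishes, \<open>M\<close> divides by 0; the signal vanishes there too.\<close>
  have R0: "R $ i $ j = 0" if "?v i = 0" for i j
  proof -
    have "Re (Q $ i $ i) = 0"
    proof (rule ccontr)
      assume nz: "Re (Q $ i $ i) \<noteq> 0"
      then have p: "0 < Re (Q $ i $ i)" using psd_diag_nonneg[OF Q(1), of i] by simp
      have "\<alpha> \<noteq> 0" using that nz \<kappa> by (auto simp: distortion_def)
      then have "0 < (1 - \<alpha>) * Re (Q $ i $ i) + \<alpha> / real CARD('t)"
        using \<alpha> p by (intro add_nonneg_pos) auto
      then show False using that \<kappa> by (simp add: distortion_def)
    qed
    then show ?thesis using Rrow[of i] by (simp add: sum_nonneg_eq_0_iff)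
  qed
  have RM: "R = \<Lambda> ** M"
    using R0 v0 by (auto simp: vec_eq_iff \<Lambda>_def M_def cdiag_mult_left)
  have Ups: "H ** Upsilon \<kappa> \<alpha> Q ** cadj H = (H ** \<Lambda>) ** cadj (H ** \<Lambda>)"
  proof -
    have "Upsilon \<kappa> \<alpha> Q = \<Lambda> ** \<Lambda>"
      by (simp add: \<Lambda>_def cdiag_mult Upsilon_eq_cdiag Q v0)
    then show ?thesis by (simp add: cadj_mult \<Lambda>_def matrix_mul_assoc)
  qed
  let ?K = "cadj (H ** \<Lambda>) ** matrix_inv (mat 1 + (H ** \<Lambda>) ** cadj (H ** \<Lambda>)) ** (H ** \<Lambda>)"
  have "psd (cadj M ** (mat 1 - ?K) ** M)"
    by (intro psd_congruence psd_regularized_projection)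
  then have "0 \<le> Re (trace (cadj M ** (mat 1 - ?K) ** M))"
    by (rule psd_trace_nonneg)
  also have "cadj M ** (mat 1 - ?K) ** M = cadj M ** M - cadj M ** ?K ** M"
  proof -
    have "cadj M ** (mat 1 - ?K) ** M + cadj M ** ?K ** M = cadj M ** ((mat 1 - ?K) + ?K) ** M"
      by (simp only: matrix_add_ldistrib cmatrix_add_rdistrib)
    then show ?thesis by (simp add: algebra_simps)
  qed
  also have "Re (trace \<dots>) = Re (trace (cadj M ** M)) - Re (trace (cadj M ** ?K ** M))"
    by (simp add: trace_sub)
  also have "cadj M ** ?K ** M = cadj (H ** R) ** matrix_inv (mat 1 + H ** Upsilon \<kappa> \<alpha> Q ** cadj H) ** (H ** R)"
    by (subst (1 2) RM) (simp add: Ups cadj_mult matrix_mul_assoc)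
  also have "trace (cadj M ** M) = trace (M ** cadj M)"
    by (rule trace_mul_sym)
  also have "Re (trace (M ** cadj M)) = (\<Sum>i\<in>UNIV. Re (Q $ i $ i) / ?v i)"
  proof -
    have "Re ((M ** cadj M) $ i $ i) = Re (Q $ i $ i) / ?v i" for i
    proof -
      have "Re ((M ** cadj M) $ i $ i) = (\<Sum>j\<in>UNIV. (cmod (M $ i $ j))\<^sup>2)"
        by (simp add: matrix_matrix_mult_def cmod_power2) (simp add: power2_eq_square)
      also have "\<dots> = (\<Sum>j\<in>UNIV. (cmod (R $ i $ j))\<^sup>2) / ?v i"
        unfolding sum_divide_distrib
        by (intro sum.cong)
          (use v0 in \<open>simp_all add: M_def cdiag_mult_left norm_mult norm_divide power_divide\<close>)
      finally show ?thesis by (simp add: Rrow)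
    qed
    then show ?thesis by (simp add: trace_def)
  qed
  finally show ?thesis
    using sum_power_over_distortion_le[OF Q \<alpha> \<kappa>] by linarith
qed

lemma psd_hermitian_square: "psd (N ** cadj N)"
  using psd_congruence'[OF pd_imp_psd[OF pd_mat_1], of N] by simp

text \<open>Multiplying by the noise covariance from the right removes the inverse. Both
  determinants are continuous in \<open>H\<close>, and the quotient is the form to which Loewner
  monotonicity applies.\<close>

lemma rate_eq_det_ratio:
  fixes H :: "complex^'t^'r"
  assumes Q: "psd Q" "trace Q = 1" and \<alpha>: "0 \<le> \<alpha>" "\<alpha> \<le> 1" and s: "0 \<le> s"
  shows "rate \<kappa> \<alpha> s H Q = log 2
    (Re (det (mat 1 + s *\<^sub>R (H ** Upsilon \<kappa> \<alpha> Q ** cadj H) + s *\<^sub>R (H ** Q ** cadj H)))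
      / Re (det (mat 1 + s *\<^sub>R (H ** Upsilon \<kappa> \<alpha> Q ** cadj H))))"
proof -
  let ?P = "mat 1 + s *\<^sub>R (H ** Upsilon \<kappa> \<alpha> Q ** cadj H)" and ?A = "s *\<^sub>R (H ** Q ** cadj H)"
  have P: "pd ?P"
    by (intro pd_add_psd pd_mat_1 psd_scaleR psd_congruence' psd_Upsilon Q \<alpha> s)
  note inv = matrix_inv_det_neq_0[OF pd_det_neq_0[OF P]]
  have "(mat 1 + ?A ** matrix_inv ?P) ** ?P = ?P + ?A ** (matrix_inv ?P ** ?P)"
    unfolding cmatrix_add_rdistrib matrix_mul_lid matrix_mul_assoc ..
  also have "\<dots> = ?P + ?A"
    by (simp only: inv matrix_mul_rid)
  finally have "det (mat 1 + ?A ** matrix_inv ?P) * det ?P = det (?P + ?A)"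
    by (metis det_mul)
  then have "det (?P + ?A) = det (mat 1 + ?A ** matrix_inv ?P) * complex_of_real (Re (det ?P))"
    by (simp only: pd_det(1)[OF P, symmetric])
  then have "Re (det (?P + ?A)) = Re (det (mat 1 + ?A ** matrix_inv ?P)) * Re (det ?P)"
    by simp
  then have "Re (det (mat 1 + ?A ** matrix_inv ?P)) = Re (det (?P + ?A)) / Re (det ?P)"
    using pd_det(2)[OF P] by simp
  then show ?thesis
    by (simp only: rate_def add.commute[of _ "mat 1"])
qed

section \<open>Bounds and monotonicity of the rate\<close>

text \<open>Jensen's inequality by way of the tangent of \<open>ln (1 + g)\<close> at
  \<open>g = c\<close>, summed over the nonzero \<open>d i\<close> only.\<close>

lemma ln_prod_one_plus_le:
  fixes d :: "'i::finite \<Rightarrow> real"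
  assumes d: "\<And>i. 0 \<le> d i" and card: "card {i. d i \<noteq> 0} \<le> M"
    and sum: "(\<Sum>i\<in>UNIV. d i) \<le> real M * c" and c: "0 \<le> c"
  shows "ln (\<Prod>i\<in>UNIV. 1 + d i) \<le> real M * ln (1 + c)"
proof -
  let ?Z = "{i. d i \<noteq> 0}"
  have tangent: "ln (1 + g) \<le> ln (1 + c) + (g - c) / (1 + c)" if "0 \<le> g" for g
  proof -
    have "ln ((1 + g) / (1 + c)) \<le> (1 + g) / (1 + c) - 1"
      using that c by (intro ln_le_minus_one) simp
    then show ?thesis
      using that c by (simp add: ln_div field_simps)
  qed
  \<comment> \<open>The tangent has a nonnegative intercept at 0, so the number of nonzero terms may
    be enlarged to \<open>M\<close>.\<close>
  have slack: "0 \<le> ln (1 + c) - c / (1 + c)"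
    using tangent[of 0] by simp
  have "ln (\<Prod>i\<in>UNIV. 1 + d i) = (\<Sum>i\<in>UNIV. ln (1 + d i))"
  proof (rule ln_prod)
    show "1 + d i \<noteq> 0" for i using d[of i] by linarith
  qed simp
  also have "\<dots> = (\<Sum>i\<in>?Z. ln (1 + d i))"
    by (intro sum.mono_neutral_right) auto
  also have "\<dots> \<le> (\<Sum>i\<in>?Z. (ln (1 + c) - c / (1 + c)) + d i / (1 + c))"
    using tangent[OF d] by (intro sum_mono) (simp add: diff_divide_distrib add_diff_eq diff_add_eq)
  also have "\<dots> = real (card ?Z) * (ln (1 + c) - c / (1 + c)) + (\<Sum>i\<in>?Z. d i) / (1 + c)"
    by (simp add: sum.distrib sum_divide_distrib)
  also have "(\<Sum>i\<in>?Z. d i) = (\<Sum>i\<in>UNIV. d i)"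
    by (intro sum.mono_neutral_left) auto
  also have "real (card ?Z) * (ln (1 + c) - c / (1 + c)) + (\<Sum>i\<in>UNIV. d i) / (1 + c)
      \<le> real M * (ln (1 + c) - c / (1 + c)) + (real M * c) / (1 + c)"
    using card sum c slack by (intro add_mono mult_right_mono divide_right_mono) auto
  also have "\<dots> = real M * ln (1 + c)" by (simp add: algebra_simps)
  finally show ?thesis .
qed

text \<open>The bounds are uniform in \<open>s\<close> and \<open>H\<close>, so they cap the
  capacity and also serve as the dominating constant under the expectation.\<close>

lemma rate_bounds:
  fixes H :: "complex^'t^'r"
  assumes Q: "psd Q" "trace Q = 1" and \<alpha>: "0 \<le> \<alpha>" "\<alpha> \<le> 1" and s: "0 \<le> s" and \<kappa>: "0 < \<kappa>"
  shows "0 \<le> rate \<kappa> \<alpha> s H Q"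
    "rate \<kappa> \<alpha> s H Q \<le> real (min CARD('t) CARD('r))
       * log 2 (1 + real CARD('t) / (real (min CARD('t) CARD('r)) * \<kappa>\<^sup>2))"
proof -
  let ?M = "min CARD('t) CARD('r)"
  \<comment> \<open>Absorbing the SNR into the channel reduces everything to unit SNR.\<close>
  define G where "G = sqrt s *\<^sub>R H"
  have G: "s *\<^sub>R (H ** X ** cadj H) = G ** X ** cadj G" for X
    using s by (simp add: G_def cadj_scaleR cscaleR_matrix_mult cmatrix_mult_scaleR)
  define P where "P = mat 1 + G ** Upsilon \<kappa> \<alpha> Q ** cadj G"
  have P: "pd P"
    unfolding P_def by (intro pd_add_psd pd_mat_1 psd_congruence' psd_Upsilon Q \<alpha>)
  obtain R where R: "cadj R = R" "R ** R = Q"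
    using psd_sqrt[OF Q(1)] by blast
  have GR: "(G ** R) ** cadj (G ** R) = G ** Q ** cadj G"
    unfolding cadj_mult R(1) R(2)[symmetric] by (simp only: matrix_mul_assoc)
  obtain d :: "'r \<Rightarrow> real" where d: "\<forall>i. 0 \<le> d i"
    "det (P + (G ** R) ** cadj (G ** R)) = det P * of_real (\<Prod>i\<in>UNIV. 1 + d i)"
    "(\<Sum>i\<in>UNIV. d i) = Re (trace (cadj (G ** R) ** matrix_inv P ** (G ** R)))"
    "card {i. d i \<noteq> 0} \<le> ?M"
    using det_ratio_eigenvalues[OF P, of "G ** R"] by blast
  have prod1: "1 \<le> (\<Prod>i\<in>UNIV. 1 + d i)"
    by (intro prod_ge_1) (simp add: d)
  have "rate \<kappa> \<alpha> s H Q = log 2 (Re (det (P + (G ** R) ** cadj (G ** R))) / Re (det P))"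
    unfolding rate_eq_det_ratio[OF Q \<alpha> s] G P_def GR ..
  also have "\<dots> = log 2 (\<Prod>i\<in>UNIV. 1 + d i)"
    using pd_det(2)[OF P] by (simp add: d(2) del: of_real_prod)
  finally have rate: "rate \<kappa> \<alpha> s H Q = ln (\<Prod>i\<in>UNIV. 1 + d i) / ln 2"
    by (simp add: log_def)
  show "0 \<le> rate \<kappa> \<alpha> s H Q"
    using prod1 by (simp add: rate)
  have "ln (\<Prod>i\<in>UNIV. 1 + d i) \<le> real ?M * ln (1 + real CARD('t) / (real ?M * \<kappa>\<^sup>2))"
  \<comment> \<open>The point of tangency is the trace bound
    \<open>CARD('t) / \<kappa>\<^sup>2\<close> shared equally among \<open>M\<close>
    eigenvalues.\<close>
  proof (rule ln_prod_one_plus_le[OF d(1)[rule_format] d(4)])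
    have "(\<Sum>i\<in>UNIV. d i) \<le> real CARD('t) / \<kappa>\<^sup>2"
      unfolding d(3) P_def by (rule whitened_signal_trace_le[OF Q \<alpha> \<kappa> R])
    then show "(\<Sum>i\<in>UNIV. d i) \<le> real ?M * (real CARD('t) / (real ?M * \<kappa>\<^sup>2))"
      by (simp add: min_def)
  qed simp
  then show "rate \<kappa> \<alpha> s H Q \<le> real ?M * log 2 (1 + real CARD('t) / (real ?M * \<kappa>\<^sup>2))"
    by (simp add: rate log_def divide_right_mono)
qed

lemma cdet_scaleR: "det (c *\<^sub>R A) = complex_of_real (c ^ CARD('n)) * det A"
  for A :: "complex^'n^'n"
proof -
  have "c *\<^sub>R A = cdiag (\<lambda>_. c) ** A"
    by (simp add: cdiag_const mat_of_real cscaleR_matrix_mult)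
  then show ?thesis
    by (simp add: det_mul det_cdiag)
qed

text \<open>Dividing both covariances by the SNR leaves the ratio of determinants unchanged and puts
  \<open>1 / s\<close> in place of the unit noise. Raising \<open>s\<close> thus removes a multiple
  of the identity from both, which is \<open>det_ratio_antimono\<close>.\<close>

lemma rate_mono:
  fixes H :: "complex^'t^'r"
  assumes Q: "psd Q" "trace Q = 1" and \<alpha>: "0 \<le> \<alpha>" "\<alpha> \<le> 1" and s: "0 < s" "s \<le> s'"
  shows "rate \<kappa> \<alpha> s H Q \<le> rate \<kappa> \<alpha> s' H Q"
proof -
  define B A where "B = H ** Upsilon \<kappa> \<alpha> Q ** cadj H" and "A = H ** Q ** cadj H"
  have B: "psd B" and A: "psd A"
    unfolding A_def B_def by (intro psd_congruence' psd_Upsilon Q \<alpha>)+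
  have pd: "pd (mat (complex_of_real (1 / z)) + B)" if "0 < z" for z
    using that by (intro pd_add_psd pd_mat B) simp
  have rate: "rate \<kappa> \<alpha> z H Q = log 2 (Re (det (mat (complex_of_real (1 / z)) + B + A))
      / Re (det (mat (complex_of_real (1 / z)) + B)))" if z: "0 < z" for z
  proof -
    have e: "mat 1 + z *\<^sub>R B = z *\<^sub>R (mat (complex_of_real (1 / z)) + B)"
      "mat 1 + z *\<^sub>R B + z *\<^sub>R A = z *\<^sub>R (mat (complex_of_real (1 / z)) + B + A)"
      using z by (simp_all add: mat_of_real scaleR_add_right del: of_real_divide)
    show ?thesis
      unfolding rate_eq_det_ratio[OF Q \<alpha> less_imp_le[OF z]] A_def[symmetric] B_def[symmetric] e(2) unfolding e(1)
      using z by (simp add: cdet_scaleR del: of_real_power of_real_divide)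
  qed
  let ?P = "mat (complex_of_real (1 / s')) + B"
  have s': "0 < s'" using s by simp
  have "mat (complex_of_real (1 / s)) + B = ?P + mat (complex_of_real (1 / s - 1 / s'))"
    unfolding mat_of_real by (simp add: algebra_simps)
  moreover have "0 \<le> 1 / s - 1 / s'"
    using s by (simp add: frac_le)
  ultimately have "Re (det (mat (complex_of_real (1 / s)) + B + A)) / Re (det (mat (complex_of_real (1 / s)) + B))
      \<le> Re (det (?P + A)) / Re (det ?P)"
    using det_ratio_antimono[OF pd[OF s'] A] by metis
  then show ?thesis
    unfolding rate[OF s(1)] rate[OF s']
    using s pd_det(2)[OF pd] pd_det(2)[OF pd_add_psd[OF pd A]]
    by (intro log_mono) (auto simp del: of_real_divide)
qed

section \<open>Measurability in the channel matrix\<close>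

lemma continuous_on_det [continuous_intros]:
  fixes f :: "'a::topological_space \<Rightarrow> complex^'n^'n"
  shows "continuous_on S f \<Longrightarrow> continuous_on S (\<lambda>x. det (f x))"
  unfolding det_def by (intro continuous_intros)

lemma continuous_on_matrix_mult [continuous_intros]:
  fixes f :: "'a::topological_space \<Rightarrow> complex^'n^'m" and g :: "'a \<Rightarrow> complex^'k^'n"
  shows "continuous_on S f \<Longrightarrow> continuous_on S g \<Longrightarrow> continuous_on S (\<lambda>x. f x ** g x)"
  unfolding matrix_matrix_mult_def by (intro continuous_intros)

lemma continuous_on_cadj [continuous_intros]:
  fixes f :: "'a::topological_space \<Rightarrow> complex^'n^'m"
  shows "continuous_on S f \<Longrightarrow> continuous_on S (\<lambda>x. cadj (f x))"
  unfolding cadj_def by (intro continuous_intros)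

lemma borel_measurable_rate:
  fixes Q :: "complex^'t^'t" and P :: "(complex^'t^'r) measure"
  assumes Q: "psd Q" "trace Q = 1" and \<alpha>: "0 \<le> \<alpha>" "\<alpha> \<le> 1" and s: "0 \<le> s"
    and sets: "sets P = sets borel"
  shows "(\<lambda>H. rate \<kappa> \<alpha> s H Q) \<in> borel_measurable P"
proof -
  have "(\<lambda>H :: complex^'t^'r. rate \<kappa> \<alpha> s H Q) \<in> borel_measurable borel"
    unfolding rate_eq_det_ratio[OF Q \<alpha> s]
    by (intro borel_measurable_log borel_measurable_const borel_measurable_divide
        borel_measurable_continuous_onI continuous_intros)
  then show ?thesis
    using measurable_cong_sets[OF sets refl] by blast
qed

section \<open>High-SNR limit under uniform power\<close>

lemma uniform_power_admissible:
  "psd (mat (complex_of_real (1 / real CARD('t))) :: complex^'t^'t)"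
  "trace (mat (complex_of_real (1 / real CARD('t))) :: complex^'t^'t) = 1"
  by (simp add: psd_mat del: of_real_divide) (simp add: trace_def mat_def)

lemma tendsto_affine_ratio:
  fixes a b :: real
  assumes "b \<noteq> 0"
  shows "((\<lambda>s. (1 + s * a) / (1 + s * b)) \<longlongrightarrow> a / b) at_top"
proof -
  have "((\<lambda>s. (inverse s + a) / (inverse s + b)) \<longlongrightarrow> (0 + a) / (0 + b)) at_top"
    using assms by (intro tendsto_intros tendsto_inverse_0_at_top filterlim_ident) simp
  moreover have "eventually (\<lambda>s. (inverse s + a) / (inverse s + b) = (1 + s * a) / (1 + s * b)) at_top"
    using eventually_gt_at_top[of 0]
  proof eventually_elim
    case (elim s)
    then have "inverse s + a = (1 + s * a) / s" "inverse s + b = (1 + s * b) / s"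
      by (simp_all add: field_simps)
    with elim show ?case by simp
  qed
  ultimately show ?thesis
    using tendsto_cong by force
qed

text \<open>Uniform power makes signal and distortion covariances multiples of the identity, so one
  unitary matrix diagonalises both determinants. Every nonzero eigenvalue of
  \<open>H ** cadj H\<close> contributes a factor tending to \<open>a / b\<close>, every zero
  eigenvalue the factor 1, and the rank counts the former.\<close>

lemma rate_uniform_power_tendsto:
  fixes H :: "complex^'t^'r"
  assumes \<alpha>: "0 \<le> \<alpha>" "\<alpha> \<le> 1" and \<kappa>: "0 < \<kappa>"
  shows "((\<lambda>s. rate \<kappa> \<alpha> s H (mat (complex_of_real (1 / real CARD('t)))))
    \<longlongrightarrow> real (rank H) * log 2 (1 + 1 / \<kappa>\<^sup>2)) at_top"
proof -
  let ?Q = "mat (complex_of_real (1 / real CARD('t))) :: complex^'t^'t"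
  note Q = uniform_power_admissible[where 't = 't]
  obtain U :: "complex^'r^'r" and d where U: "cadj U ** U = mat 1" "U ** cadj U = mat 1"
    "H ** cadj H = U ** cdiag d ** cadj U" "\<And>i. 0 \<le> d i"
    using psd_spectral[OF psd_hermitian_square[of H]] by blast
  note rank = rank_unitary_diagonal[OF U(1-3)]
  \<comment> \<open>Per-antenna powers: \<open>b\<close> of the distortion alone, \<open>a\<close>
    of signal plus distortion.\<close>
  define b a where "b = \<kappa>\<^sup>2 / real CARD('t)" and "a = b + 1 / real CARD('t)"
  have b: "0 < b" using \<kappa> by (simp add: b_def)
  then have a: "0 < a" by (simp add: a_def add_pos_nonneg)
  have ab: "a / b = 1 + 1 / \<kappa>\<^sup>2"
    using \<kappa> by (simp add: a_def b_def field_simps)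
  have "distortion \<kappa> \<alpha> ?Q = (\<lambda>_. b)"
    by (simp add: fun_eq_iff distortion_def mat_def b_def field_simps)
  then have Ups: "Upsilon \<kappa> \<alpha> ?Q = mat (complex_of_real b)"
    by (simp only: Upsilon_eq_cdiag[OF Q(2)] cdiag_const)
  have factor: "(\<Prod>i\<in>UNIV. 1 + s * (a * d i)) / (\<Prod>i\<in>UNIV. 1 + s * (b * d i))
      = (\<Prod>i\<in>UNIV. (1 + s * (a * d i)) / (1 + s * (b * d i)))" for s
    by (rule prod_dividef[symmetric])
  have "rate \<kappa> \<alpha> s H ?Q = log 2 (\<Prod>i\<in>UNIV. (1 + s * (a * d i)) / (1 + s * (b * d i)))"
    if s: "0 \<le> s" for s
  proof -
    have e: "mat 1 + s *\<^sub>R (H ** mat (complex_of_real b) ** cadj H) = U ** cdiag (\<lambda>i. 1 + s * (b * d i)) ** cadj U"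
      using add_unitary_conjugation[OF U(2), of 1 "s * b" d]
      by (simp add: mat_of_real cscaleR_matrix_mult cmatrix_mult_scaleR U(3)[symmetric] mult.assoc)
    have "mat 1 + s *\<^sub>R (H ** mat (complex_of_real b) ** cadj H) + s *\<^sub>R (H ** ?Q ** cadj H)
        = mat 1 + (s * a) *\<^sub>R (H ** cadj H)"
      unfolding mat_of_real
      by (simp add: cscaleR_matrix_mult cmatrix_mult_scaleR a_def algebra_simps)
    also have "\<dots> = U ** cdiag (\<lambda>i. 1 + s * (a * d i)) ** cadj U"
      using add_unitary_conjugation[OF U(2), of 1 "s * a" d] by (simp add: U(3) mult.assoc)
    finally show ?thesis
      unfolding rate_eq_det_ratio[OF Q \<alpha> s] Ups
      by (simp only: e det_unitary_conjugation[OF U(2)] det_cdiag Re_complex_of_real factor)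
  qed
  then have ev: "eventually (\<lambda>s. log 2 (\<Prod>i\<in>UNIV. (1 + s * (a * d i)) / (1 + s * (b * d i)))
      = rate \<kappa> \<alpha> s H ?Q) at_top"
    by (intro eventually_mono[OF eventually_ge_at_top[of 0]]) (rule sym)
  have "((\<lambda>s. (1 + s * (a * d i)) / (1 + s * (b * d i))) \<longlongrightarrow> (if d i \<noteq> 0 then a / b else 1)) at_top" for i
    using tendsto_affine_ratio[of "b * d i" "a * d i"] b by auto
  then have "((\<lambda>s. \<Prod>i\<in>UNIV. (1 + s * (a * d i)) / (1 + s * (b * d i)))
      \<longlongrightarrow> (\<Prod>i\<in>UNIV. if d i \<noteq> 0 then a / b else 1)) at_top"
    by (intro tendsto_prod)
  also have "(\<Prod>i\<in>UNIV. if d i \<noteq> 0 then a / b else 1) = (a / b) ^ rank H"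
    by (simp add: prod.If_cases rank)
  finally have "((\<lambda>s. log 2 (\<Prod>i\<in>UNIV. (1 + s * (a * d i)) / (1 + s * (b * d i))))
      \<longlongrightarrow> log 2 ((a / b) ^ rank H)) at_top"
    using a b by (intro tendsto_log) auto
  also have "log 2 ((a / b) ^ rank H) = real (rank H) * log 2 (1 + 1 / \<kappa>\<^sup>2)"
    unfolding ab[symmetric] using a b by (intro log_nat_power) simp
  finally show ?thesis
    using ev by (rule Lim_transform_eventually)
qed

section \<open>Convergence of the capacity\<close>

text \<open>Monotone convergence with hypotheses only beyond \<open>a\<close>; it is applied with
  \<open>a = 0\<close>, as the capacity is controlled for positive SNR.\<close>

lemma tendsto_Sup_at_top:
  fixes f :: "real \<Rightarrow> real"
  assumes mono: "\<And>x y. a < x \<Longrightarrow> x \<le> y \<Longrightarrow> f x \<le> f y" and bdd: "\<And>x. a < x \<Longrightarrow> f x \<le> B"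
  shows "(f \<longlongrightarrow> (SUP x\<in>{a<..}. f x)) at_top"
proof -
  have bd: "bdd_above (f ` {a<..})"
    using bdd by (auto intro!: bdd_aboveI2)
  show ?thesis
  proof (rule order_tendstoI)
    fix y assume "y < (SUP x\<in>{a<..}. f x)"
    then obtain x where x: "a < x" "y < f x"
      using less_cSUP_iff[OF _ bd] by auto
    show "eventually (\<lambda>x. y < f x) at_top"
      using eventually_ge_at_top[of x] by eventually_elim (use x mono in \<open>force intro: less_le_trans\<close>)
  next
    fix y assume y: "(SUP x\<in>{a<..}. f x) < y"
    show "eventually (\<lambda>x. f x < y) at_top"
      using eventually_gt_at_top[of a]
      by eventually_elim (use y bd in \<open>auto intro: le_less_trans[OF cSUP_upper]\<close>)
  qed
qed

theorem theorem1:
  fixes P :: "(complex^'t^'r) measure" and \<kappa> \<alpha> :: real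
  assumes "prob_space P"
    and "sets P = sets borel"
    and "integrable P (\<lambda>H. trace (cadj H ** H))"
    and "integral\<^sup>L P (\<lambda>H. trace (cadj H ** H)) = of_nat (CARD('t) * CARD('r))"
    and "AE H in P. rank H = min CARD('t) CARD('r)"
    and "0 \<le> \<alpha>" and "\<alpha> \<le> 1" and "0 < \<kappa>"
  shows "\<exists>Cinf :: real.
     ((\<lambda>snr. capacity P \<kappa> \<alpha> snr) \<longlongrightarrow> Cinf) at_top
     \<and> real (min CARD('t) CARD('r)) * log 2 (1 + 1 / \<kappa>\<^sup>2) \<le> Cinf
     \<and> Cinf \<le> real (min CARD('t) CARD('r))
              * log 2 (1 + real CARD('t) / (real (min CARD('t) CARD('r)) * \<kappa>\<^sup>2))
     \<and> ((\<lambda>snr. avg_rate P \<kappa> \<alpha> snr (mat (complex_of_real (1 / real CARD('t)))))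
          \<longlongrightarrow> real (min CARD('t) CARD('r)) * log 2 (1 + 1 / \<kappa>\<^sup>2)) at_top
     \<and> (CARD('t) \<le> CARD('r) \<longrightarrow>
          real (min CARD('t) CARD('r)) * log 2 (1 + 1 / \<kappa>\<^sup>2)
          = real (min CARD('t) CARD('r))
              * log 2 (1 + real CARD('t) / (real (min CARD('t) CARD('r)) * \<kappa>\<^sup>2)))"
proof -
  interpret prob_space P by fact
  note \<alpha> = assms(6,7) and \<kappa> = assms(8) and sets = assms(2)
  let ?Q = "mat (complex_of_real (1 / real CARD('t))) :: complex^'t^'t"
  define lo where "lo = real (min CARD('t) CARD('r)) * log 2 (1 + 1 / \<kappa>\<^sup>2)"
  define hi where "hi = real (min CARD('t) CARD('r))
      * log 2 (1 + real CARD('t) / (real (min CARD('t) CARD('r)) * \<kappa>\<^sup>2))"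
  note bounds = rate_bounds[where 't = 't and 'r = 'r, OF _ _ \<alpha> _ \<kappa>, folded hi_def]
  note admissible = uniform_power_admissible[where 't = 't]
  \<comment> \<open>Needed to compare averages: the integral of a non-integrable function is 0 by
    convention.\<close>
  have integrable: "integrable P (\<lambda>H. rate \<kappa> \<alpha> s H Q)" if "psd Q" "trace Q = 1" "0 \<le> s" for s Q
    using bounds[OF that] borel_measurable_rate[OF that(1,2) \<alpha> that(3) sets]
    by (intro integrable_const_bound[where B = hi]) auto
  have avg_le: "avg_rate P \<kappa> \<alpha> s Q \<le> hi" if "psd Q" "trace Q = 1" "0 \<le> s" for s Q
    unfolding avg_rate_def using bounds(2)[OF that] integrable[OF that]
    by (intro integral_le_const) auto
  have avg_mono: "avg_rate P \<kappa> \<alpha> s Q \<le> avg_rate P \<kappa> \<alpha> s' Q"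
    if "psd Q" "trace Q = 1" "0 < s" "s \<le> s'" for s s' Q
    unfolding avg_rate_def using that
    by (intro integral_mono integrable rate_mono \<alpha>) auto
  let ?A = "{Q :: complex^'t^'t. psd Q \<and> trace Q = 1}"
  \<comment> \<open>\<open>Sup\<close> on the reals is a genuine supremum only for nonempty sets
    that are bounded above; \<open>ne\<close> and \<open>bdd\<close> secure both.\<close>
  have ne: "?A \<noteq> {}" using admissible by blast
  have bdd: "bdd_above (avg_rate P \<kappa> \<alpha> s ` ?A)" if "0 \<le> s" for s
    using avg_le that by (intro bdd_aboveI2) auto
  have cap_le: "capacity P \<kappa> \<alpha> s \<le> hi" if "0 < s" for s
    unfolding capacity_def using avg_le that by (intro cSUP_least ne) auto
  have cap_mono: "capacity P \<kappa> \<alpha> s \<le> capacity P \<kappa> \<alpha> s'" if "0 < s" "s \<le> s'" for s s'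
    unfolding capacity_def using that bdd avg_mono by (intro cSUP_mono ne) auto
  have avg_le_cap: "avg_rate P \<kappa> \<alpha> s ?Q \<le> capacity P \<kappa> \<alpha> s" if "0 < s" for s
    unfolding capacity_def using that bdd admissible by (intro cSUP_upper) auto
  obtain C where C: "((\<lambda>s. capacity P \<kappa> \<alpha> s) \<longlongrightarrow> C) at_top"
    using tendsto_Sup_at_top[of 0 "capacity P \<kappa> \<alpha>" hi] cap_mono cap_le by blast
  have lim: "((\<lambda>s. avg_rate P \<kappa> \<alpha> s ?Q) \<longlongrightarrow> lo) at_top"
  proof -
    \<comment> \<open>Dominated convergence asks for measurability at every \<open>s\<close>, also negative ones: hence \<open>max 0 s\<close>.\<close>
    have "((\<lambda>s. integral\<^sup>L P (\<lambda>H. rate \<kappa> \<alpha> (max 0 s) H ?Q)) \<longlongrightarrow> integral\<^sup>L P (\<lambda>_. lo)) at_top"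
    proof (rule integral_dominated_convergence_at_top[where w = "\<lambda>_. hi"])
      show "AE H in P. ((\<lambda>s. rate \<kappa> \<alpha> (max 0 s) H ?Q) \<longlongrightarrow> lo) at_top"
        \<comment> \<open>Almost sure full rank turns the limit, which depends on
          \<open>rank H\<close>, into the constant \<open>lo\<close>.\<close>
        using assms(5)
      proof eventually_elim
        case (elim H)
        show ?case
          using rate_uniform_power_tendsto[OF \<alpha> \<kappa>, of H] unfolding elim lo_def
          by (rule Lim_transform_eventually)
            (rule eventually_mono[OF eventually_ge_at_top[of 0]], simp add: max_absorb2)
      qed
    next
      show "\<forall>\<^sub>F s in at_top. AE H in P. norm (rate \<kappa> \<alpha> (max 0 s) H ?Q) \<le> hi"
        using bounds[OF admissible] by simp
    qed (use borel_measurable_rate[OF admissible \<alpha> _ sets] in auto)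
    then have "((\<lambda>s. avg_rate P \<kappa> \<alpha> (max 0 s) ?Q) \<longlongrightarrow> lo) at_top"
      by (simp add: avg_rate_def prob_space)
    then show ?thesis
      by (rule Lim_transform_eventually)
        (rule eventually_mono[OF eventually_ge_at_top[of 0]], simp add: max_absorb2)
  qed
  \<comment> \<open>Uniform power is admissible, so its average rate stays below the capacity, and
    so does its limit.\<close>
  have "lo \<le> C"
    using C lim
    by (rule tendsto_le[OF trivial_limit_at_top_linorder])
      (rule eventually_mono[OF eventually_gt_at_top[of 0] avg_le_cap])
  moreover have "C \<le> hi"
    using C
    by (rule tendsto_upperbound)
      (rule eventually_mono[OF eventually_gt_at_top[of 0] cap_le], simp_all)
  \<comment> \<open>Here the minimum is \<open>CARD('t)\<close>, which cancels inside the logarithm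
    of \<open>hi\<close>.\<close>
  moreover have "lo = hi" if "CARD('t) \<le> CARD('r)"
    using that by (simp add: lo_def hi_def min_absorb1)
  ultimately show ?thesis
    using C lim unfolding lo_def hi_def by blast
qed

end
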